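(* Let $\tilde M$ be a Sasakian manifold. There does not exist any proper pointwise semi-slant warped product submanifold of $\tilde M$ other than contact CR-warped products. That is, there is no submanifold $M$ of $\tilde M$, tangent to the structure vector field $\xi$, which is a warped product $M=M_\theta\times_f M_T$ or $M=M_T\times_f M_\theta$ of an invariant submanifold $M_T$ and a pointwise slant submanifold $M_\theta$ of $\tilde M$, which is proper, and which is not a contact CR-warped product.
   Context: An almost contact metric manifold $(\tilde M,\varphi,\xi,\eta,g)$ is an odd-dimensional manifold with a $(1,1)$-tensor field $\varphi$, a vector field $\xi$, a 1-form $\eta$ and a Riemannian metric $g$ such that $\varphi^2=-I+\eta\otimes\xi$, $\eta(\xi)=1$, $\varphi\xi=0$, $\eta\circ\varphi=0$, $g(\varphi X,\varphi Y)=g(X,Y)-\eta(X)\eta(Y)$. It is Sasakian if, with $\tilde\nabla$ the Levi-Civita connection of $g$, $(\tilde\nabla_X\varphi)Y=g(X,Y)\xi-\eta(Y)X$ for all $X,Y$ (so that $\tilde\nabla_X\xi=-\varphi X$). Submanifolds carry the induced metric. A submanifold $N$ of $\tilde M$ is invariant if $\varphi(TN)\subset TN$. It is pointwise slant if at each $p\in N$ the angle $\theta$ between $\varphi X$ and $T_pN$ is the same for all nonzero $X\in T_pN$ not proportional to $\xi_p$; $\theta$ is then a function, called the slant function. It is a proper pointwise slant submanifold if neither $\theta=0$ nor $\theta=\pi/2$ and $\theta$ is not constant. The warped product $M_1\times_f M_2$ of Riemannian manifolds $(M_1,g_1)$, $(M_2,g_2)$, with $f>0$ a smooth function on $M_1$,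 is $M_1\times M_2$ with the metric $\pi_1^*g_1+(f\circ\pi_1)^2\pi_2^*g_2$, where $\pi_1$ and $\pi_2$ are the projections of $M_1\times M_2$ onto $M_1$ and $M_2$. A pointwise semi-slant warped product submanifold of $\tilde M$ is a submanifold $M$ of $\tilde M$ which (with the induced metric) is a warped product of an invariant submanifold $M_T$ and a pointwise slant submanifold $M_\theta$ of $\tilde M$ (in either order). All such submanifolds are assumed tangent to $\xi$, and either $\xi$ is tangent to $M_T$ or $\xi$ is tangent to $M_\theta$. Such a warped product is proper if $M_\theta$ is a proper pointwise slant submanifold, $M_T$ is an invariant submanifold, and the warping function $f$ is non-constant. A contact CR-warped product is a submanifold of $\tilde M$, tangent to $\xi$, which (with the induced metric) is a warped product $M_T\times_f M_\theta$ of an invariant submanifold $M_T$ and a pointwise slant submanifold $M_\theta$ of $\tilde M$ with slant function $\theta=\pi/2$ identically (i.e. $M_\theta$ anti-invariant). *)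

theory Defs
  imports "HOL-Analysis.Analysis"
begin

section \<open>Smooth maps between Euclidean spaces\<close>

text \<open>Only used for open sets; in finite dimension continuity of all iterated directional
  derivatives is the usual notion of a map of class C-infinity.\<close>

primrec Ck_on :: "nat \<Rightarrow> ('a::real_normed_vector \<Rightarrow> 'b::real_normed_vector) \<Rightarrow> 'a set \<Rightarrow> bool" where
  "Ck_on 0 f S \<longleftrightarrow> continuous_on S f"
| "Ck_on (Suc k) f S \<longleftrightarrow> (\<forall>x\<in>S. f differentiable (at x)) \<and>
     (\<forall>v. Ck_on k (\<lambda>x. frechet_derivative f (at x) v) S)"

definition smooth_on :: "'a::real_normed_vector set \<Rightarrow> ('a \<Rightarrow> 'b::real_normed_vector) \<Rightarrow> bool" where
  "smooth_on S f \<longleftrightarrow> (\<forall>k. Ck_on k f S)"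


section \<open>Smooth manifolds\<close>

text \<open>A manifold is a whole (Hausdorff, second countable) type with a smooth atlas. A chart is a
  pair of its domain and its coordinate map; the values of the coordinate map outside the domain
  are irrelevant. Since a Euclidean space type has dimension at least 1, so has every manifold
  (for a point \<open>M_T\<close>, every submanifold \<open>M_\<theta>\<close> would trivially be a warped product). Connectedness
  is not required.\<close>

type_synonym ('m, 'e) chart = "'m set \<times> ('m \<Rightarrow> 'e)"

definition chart_inv :: "('m, 'e) chart \<Rightarrow> 'e \<Rightarrow> 'm" where
  "chart_inv c = inv_into (fst c) (snd c)"

definition smooth_manifold ::
  "('m::{t2_space,second_countable_topology}, 'e::euclidean_space) chart set \<Rightarrow> bool" where
  "smooth_manifold A \<longleftrightarrow>
     (\<Union>c\<in>A. fst c) = UNIV \<and>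
     (\<forall>c\<in>A. open (fst c) \<and> open (snd c ` fst c) \<and>
        homeomorphism (fst c) (snd c ` fst c) (snd c) (chart_inv c)) \<and>
     (\<forall>c\<in>A. \<forall>d\<in>A. smooth_on (snd c ` (fst c \<inter> fst d)) (snd d \<circ> chart_inv c))"

definition prod_chart :: "('m, 'e) chart \<Rightarrow> ('n, 'f) chart \<Rightarrow> ('m \<times> 'n, 'e \<times> 'f) chart" where
  "prod_chart a b = (fst a \<times> fst b, map_prod (snd a) (snd b))"

definition prod_atlas ::
  "('m, 'e) chart set \<Rightarrow> ('n, 'f) chart set \<Rightarrow> ('m \<times> 'n, 'e \<times> 'f) chart set" where
  "prod_atlas A B = {prod_chart a b | a b. a \<in> A \<and> b \<in> B}"

definition smooth_function ::
  "('m, 'e::euclidean_space) chart set \<Rightarrow> ('m \<Rightarrow> real) \<Rightarrow> bool" where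
  "smooth_function A f \<longleftrightarrow> (\<forall>c\<in>A. smooth_on (snd c ` fst c) (f \<circ> chart_inv c))"

definition smooth_map ::
  "('n::topological_space, 'f::euclidean_space) chart set \<Rightarrow>
   ('m::topological_space, 'e::euclidean_space) chart set \<Rightarrow> ('n \<Rightarrow> 'm) \<Rightarrow> bool" where
  "smooth_map B A F \<longleftrightarrow> continuous_on UNIV F \<and>
     (\<forall>b\<in>B. \<forall>c\<in>A. smooth_on (snd b ` (fst b \<inter> F -` fst c)) (snd c \<circ> F \<circ> chart_inv b))"

text \<open>The differential of \<open>F\<close> at \<open>p\<close>, as a linear map between the coordinate vectors with respect
  to a chart \<open>b\<close> around \<open>p\<close> and a chart \<open>c\<close> around \<open>F p\<close>.\<close>

definition differential ::
  "('n, 'f::euclidean_space) chart \<Rightarrow> ('m, 'e::euclidean_space) chart \<Rightarrow> ('n \<Rightarrow> 'm) \<Rightarrow> 'n \<Rightarrow> 'f \<Rightarrow> 'e"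
  where
  "differential b c F p = frechet_derivative (snd c \<circ> F \<circ> chart_inv b) (at (snd b p))"

definition chart_change ::
  "('m, 'e::euclidean_space) chart \<Rightarrow> ('m, 'e) chart \<Rightarrow> 'm \<Rightarrow> 'e \<Rightarrow> 'e" where
  "chart_change c d p = differential c d id p"


section \<open>Tensor fields\<close>

text \<open>A tensor field is given by its components in every chart of the atlas, evaluated at points of
  the manifold: tangent vectors at \<open>p\<close> are expressed by their coordinate vectors in a chart around
  \<open>p\<close>. The components are smooth and obey the transformation law of the tensor type. Values for
  points outside the chart are irrelevant.\<close>

definition vector_field ::
  "('m, 'e::euclidean_space) chart set \<Rightarrow> (('m, 'e) chart \<Rightarrow> 'm \<Rightarrow> 'e) \<Rightarrow> bool" where
  "vector_field A X \<longleftrightarrow>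
     (\<forall>c\<in>A. smooth_on (snd c ` fst c) (\<lambda>x. X c (chart_inv c x))) \<and>
     (\<forall>c\<in>A. \<forall>d\<in>A. \<forall>p\<in>fst c \<inter> fst d. X d p = chart_change c d p (X c p))"

definition one_form ::
  "('m, 'e::euclidean_space) chart set \<Rightarrow> (('m, 'e) chart \<Rightarrow> 'm \<Rightarrow> 'e \<Rightarrow> real) \<Rightarrow> bool" where
  "one_form A \<eta> \<longleftrightarrow>
     (\<forall>c\<in>A. \<forall>p\<in>fst c. linear (\<eta> c p)) \<and>
     (\<forall>c\<in>A. \<forall>u. smooth_on (snd c ` fst c) (\<lambda>x. \<eta> c (chart_inv c x) u)) \<and>
     (\<forall>c\<in>A. \<forall>d\<in>A. \<forall>p\<in>fst c \<inter> fst d. \<forall>u. \<eta> d p (chart_change c d p u) = \<eta> c p u)"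

definition tensor_field_1_1 ::
  "('m, 'e::euclidean_space) chart set \<Rightarrow> (('m, 'e) chart \<Rightarrow> 'm \<Rightarrow> 'e \<Rightarrow> 'e) \<Rightarrow> bool" where
  "tensor_field_1_1 A \<phi> \<longleftrightarrow>
     (\<forall>c\<in>A. \<forall>p\<in>fst c. linear (\<phi> c p)) \<and>
     (\<forall>c\<in>A. \<forall>u. smooth_on (snd c ` fst c) (\<lambda>x. \<phi> c (chart_inv c x) u)) \<and>
     (\<forall>c\<in>A. \<forall>d\<in>A. \<forall>p\<in>fst c \<inter> fst d. \<forall>u.
        \<phi> d p (chart_change c d p u) = chart_change c d p (\<phi> c p u))"

definition riemannian_metric ::
  "('m, 'e::euclidean_space) chart set \<Rightarrow> (('m, 'e) chart \<Rightarrow> 'm \<Rightarrow> 'e \<Rightarrow> 'e \<Rightarrow> real) \<Rightarrow> bool" where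
  "riemannian_metric A g \<longleftrightarrow>
     (\<forall>c\<in>A. \<forall>p\<in>fst c. bilinear (g c p) \<and> (\<forall>u v. g c p u v = g c p v u) \<and>
        (\<forall>u. u \<noteq> 0 \<longrightarrow> g c p u u > 0)) \<and>
     (\<forall>c\<in>A. \<forall>u v. smooth_on (snd c ` fst c) (\<lambda>x. g c (chart_inv c x) u v)) \<and>
     (\<forall>c\<in>A. \<forall>d\<in>A. \<forall>p\<in>fst c \<inter> fst d. \<forall>u v.
        g d p (chart_change c d p u) (chart_change c d p v) = g c p u v)"


section \<open>Levi-Civita connection\<close>

text \<open>A connection is given by its Christoffel symbols: \<open>\<Gamma> c p u v\<close> is the covariant derivative at
  \<open>p\<close> in direction \<open>u\<close> of the vector field with constant components \<open>v\<close> in the chart \<open>c\<close>.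
  Symmetry of \<open>\<Gamma>\<close> is vanishing torsion and the last clause says that the metric is parallel. These
  conditions determine \<open>\<Gamma>\<close> uniquely on every chart, so its smoothness and the transformation law of
  a connection need not be demanded.\<close>

definition levi_civita ::
  "('m, 'e::euclidean_space) chart set \<Rightarrow> (('m, 'e) chart \<Rightarrow> 'm \<Rightarrow> 'e \<Rightarrow> 'e \<Rightarrow> real) \<Rightarrow>
   (('m, 'e) chart \<Rightarrow> 'm \<Rightarrow> 'e \<Rightarrow> 'e \<Rightarrow> 'e) \<Rightarrow> bool" where
  "levi_civita A g \<Gamma> \<longleftrightarrow> (\<forall>c\<in>A. \<forall>p\<in>fst c.
     bilinear (\<Gamma> c p) \<and>
     (\<forall>u v. \<Gamma> c p u v = \<Gamma> c p v u) \<and>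
     (\<forall>u v w. frechet_derivative (\<lambda>x. g c (chart_inv c x) v w) (at (snd c p)) u =
        g c p (\<Gamma> c p u v) w + g c p v (\<Gamma> c p u w)))"

definition cov_deriv_1_1 ::
  "(('m, 'e) chart \<Rightarrow> 'm \<Rightarrow> 'e \<Rightarrow> 'e \<Rightarrow> 'e) \<Rightarrow> (('m, 'e) chart \<Rightarrow> 'm \<Rightarrow> 'e \<Rightarrow> 'e) \<Rightarrow>
   ('m, 'e::euclidean_space) chart \<Rightarrow> 'm \<Rightarrow> 'e \<Rightarrow> 'e \<Rightarrow> 'e" where
  "cov_deriv_1_1 \<Gamma> \<phi> c p u v =
     frechet_derivative (\<lambda>x. \<phi> c (chart_inv c x) v) (at (snd c p)) u
     + \<Gamma> c p u (\<phi> c p v) - \<phi> c p (\<Gamma> c p u v)"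


section \<open>Almost contact metric and Sasakian manifolds\<close>

definition almost_contact_metric_manifold ::
  "('m::{t2_space,second_countable_topology}, 'e::euclidean_space) chart set \<Rightarrow>
   (('m, 'e) chart \<Rightarrow> 'm \<Rightarrow> 'e \<Rightarrow> 'e) \<Rightarrow> (('m, 'e) chart \<Rightarrow> 'm \<Rightarrow> 'e) \<Rightarrow>
   (('m, 'e) chart \<Rightarrow> 'm \<Rightarrow> 'e \<Rightarrow> real) \<Rightarrow> (('m, 'e) chart \<Rightarrow> 'm \<Rightarrow> 'e \<Rightarrow> 'e \<Rightarrow> real) \<Rightarrow> bool" where
  "almost_contact_metric_manifold A \<phi> \<xi> \<eta> g \<longleftrightarrow>
     smooth_manifold A \<and> odd DIM('e) \<and>
     tensor_field_1_1 A \<phi> \<and> vector_field A \<xi> \<and> one_form A \<eta> \<and> riemannian_metric A g \<and>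
     (\<forall>c\<in>A. \<forall>p\<in>fst c.
        (\<forall>u. \<phi> c p (\<phi> c p u) = - u + \<eta> c p u *\<^sub>R \<xi> c p) \<and>
        \<eta> c p (\<xi> c p) = 1 \<and>
        \<phi> c p (\<xi> c p) = 0 \<and>
        (\<forall>u. \<eta> c p (\<phi> c p u) = 0) \<and>
        (\<forall>u v. g c p (\<phi> c p u) (\<phi> c p v) = g c p u v - \<eta> c p u * \<eta> c p v))"

definition sasakian_manifold ::
  "('m::{t2_space,second_countable_topology}, 'e::euclidean_space) chart set \<Rightarrow>
   (('m, 'e) chart \<Rightarrow> 'm \<Rightarrow> 'e \<Rightarrow> 'e) \<Rightarrow> (('m, 'e) chart \<Rightarrow> 'm \<Rightarrow> 'e) \<Rightarrow>
   (('m, 'e) chart \<Rightarrow> 'm \<Rightarrow> 'e \<Rightarrow> real) \<Rightarrow> (('m, 'e) chart \<Rightarrow> 'm \<Rightarrow> 'e \<Rightarrow> 'e \<Rightarrow> real) \<Rightarrow> bool" where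
  "sasakian_manifold A \<phi> \<xi> \<eta> g \<longleftrightarrow>
     almost_contact_metric_manifold A \<phi> \<xi> \<eta> g \<and>
     (\<exists>\<Gamma>. levi_civita A g \<Gamma> \<and>
        (\<forall>c\<in>A. \<forall>p\<in>fst c. \<forall>u v.
           cov_deriv_1_1 \<Gamma> \<phi> c p u v = g c p u v *\<^sub>R \<xi> c p - \<eta> c p v *\<^sub>R u))"


section \<open>Submanifolds\<close>

text \<open>Submanifolds are immersed: a submanifold is a manifold together with an immersion into the
  ambient manifold. Embedded submanifolds are the special case of an inclusion map.\<close>

definition immersion ::
  "('n::topological_space, 'f::euclidean_space) chart set \<Rightarrow>
   ('m::topological_space, 'e::euclidean_space) chart set \<Rightarrow> ('n \<Rightarrow> 'm) \<Rightarrow> bool" where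
  "immersion B A i \<longleftrightarrow> smooth_map B A i \<and>
     (\<forall>b\<in>B. \<forall>c\<in>A. \<forall>p\<in>fst b. i p \<in> fst c \<longrightarrow> inj (differential b c i p))"

text \<open>The tangent space of the submanifold at \<open>p\<close>, as a subspace of the ambient tangent space at
  \<open>i p\<close>; it does not depend on the chart \<open>b\<close> of the submanifold.\<close>

definition tangent_space_in ::
  "('n, 'f::euclidean_space) chart \<Rightarrow> ('m, 'e::euclidean_space) chart \<Rightarrow> ('n \<Rightarrow> 'm) \<Rightarrow> 'n \<Rightarrow> 'e set"
  where
  "tangent_space_in b c i p = range (differential b c i p)"

definition tangent_along ::
  "('n, 'f::euclidean_space) chart set \<Rightarrow> ('m, 'e::euclidean_space) chart set \<Rightarrow>
   (('m, 'e) chart \<Rightarrow> 'm \<Rightarrow> 'e) \<Rightarrow> ('n \<Rightarrow> 'm) \<Rightarrow> bool" where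
  "tangent_along B A \<xi> i \<longleftrightarrow>
     (\<forall>b\<in>B. \<forall>c\<in>A. \<forall>p\<in>fst b. i p \<in> fst c \<longrightarrow> \<xi> c (i p) \<in> tangent_space_in b c i p)"

definition invariant_submanifold ::
  "('n::{t2_space,second_countable_topology}, 'f::euclidean_space) chart set \<Rightarrow>
   ('m::{t2_space,second_countable_topology}, 'e::euclidean_space) chart set \<Rightarrow>
   (('m, 'e) chart \<Rightarrow> 'm \<Rightarrow> 'e \<Rightarrow> 'e) \<Rightarrow> ('n \<Rightarrow> 'm) \<Rightarrow> bool" where
  "invariant_submanifold B A \<phi> i \<longleftrightarrow> smooth_manifold B \<and> immersion B A i \<and>
     (\<forall>b\<in>B. \<forall>c\<in>A. \<forall>p\<in>fst b. i p \<in> fst c \<longrightarrow>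
        \<phi> c (i p) ` tangent_space_in b c i p \<subseteq> tangent_space_in b c i p)"

definition orth_proj :: "('e::euclidean_space \<Rightarrow> 'e \<Rightarrow> real) \<Rightarrow> 'e set \<Rightarrow> 'e \<Rightarrow> 'e" where
  "orth_proj G W v = (THE t. t \<in> W \<and> (\<forall>w\<in>W. G (v - t) w = 0))"

text \<open>The angle (between 0 and \<open>pi / 2\<close>) of a nonzero vector \<open>v\<close> and a subspace \<open>W\<close>, with respect to
  the inner product \<open>G\<close>.\<close>

definition angle_subspace :: "('e::euclidean_space \<Rightarrow> 'e \<Rightarrow> real) \<Rightarrow> 'e \<Rightarrow> 'e set \<Rightarrow> real" where
  "angle_subspace G v W =
     arccos (sqrt (G (orth_proj G W v) (orth_proj G W v)) / sqrt (G v v))"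

definition pointwise_slant_submanifold ::
  "('n::{t2_space,second_countable_topology}, 'f::euclidean_space) chart set \<Rightarrow>
   ('m::{t2_space,second_countable_topology}, 'e::euclidean_space) chart set \<Rightarrow>
   (('m, 'e) chart \<Rightarrow> 'm \<Rightarrow> 'e \<Rightarrow> 'e) \<Rightarrow> (('m, 'e) chart \<Rightarrow> 'm \<Rightarrow> 'e) \<Rightarrow>
   (('m, 'e) chart \<Rightarrow> 'm \<Rightarrow> 'e \<Rightarrow> 'e \<Rightarrow> real) \<Rightarrow> ('n \<Rightarrow> 'm) \<Rightarrow> ('n \<Rightarrow> real) \<Rightarrow> bool" where
  "pointwise_slant_submanifold B A \<phi> \<xi> g i \<theta> \<longleftrightarrow> smooth_manifold B \<and> immersion B A i \<and>
     (\<forall>b\<in>B. \<forall>c\<in>A. \<forall>p\<in>fst b. i p \<in> fst c \<longrightarrow>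
        (\<forall>X\<in>tangent_space_in b c i p. X \<noteq> 0 \<and> X \<notin> span {\<xi> c (i p)} \<longrightarrow>
           angle_subspace (g c (i p)) (\<phi> c (i p) X) (tangent_space_in b c i p) = \<theta> p))"

definition proper_pointwise_slant_submanifold ::
  "('n::{t2_space,second_countable_topology}, 'f::euclidean_space) chart set \<Rightarrow>
   ('m::{t2_space,second_countable_topology}, 'e::euclidean_space) chart set \<Rightarrow>
   (('m, 'e) chart \<Rightarrow> 'm \<Rightarrow> 'e \<Rightarrow> 'e) \<Rightarrow> (('m, 'e) chart \<Rightarrow> 'm \<Rightarrow> 'e) \<Rightarrow>
   (('m, 'e) chart \<Rightarrow> 'm \<Rightarrow> 'e \<Rightarrow> 'e \<Rightarrow> real) \<Rightarrow> ('n \<Rightarrow> 'm) \<Rightarrow> ('n \<Rightarrow> real) \<Rightarrow> bool" where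
  "proper_pointwise_slant_submanifold B A \<phi> \<xi> g i \<theta> \<longleftrightarrow>
     pointwise_slant_submanifold B A \<phi> \<xi> g i \<theta> \<and>
     \<theta> \<noteq> (\<lambda>_. 0) \<and> \<theta> \<noteq> (\<lambda>_. pi / 2) \<and> \<not> \<theta> constant_on UNIV"


section \<open>Warped product submanifolds\<close>

text \<open>The metric \<open>\<pi>\<^sub>1\<^sup>*g\<^sub>1 + (f \<circ> \<pi>\<^sub>1)\<^sup>2 \<pi>\<^sub>2\<^sup>*g\<^sub>2\<close>, in the product of a chart \<open>a\<close> of the first factor and a
  chart \<open>b\<close> of the second factor.\<close>

definition warped_metric ::
  "(('p, 'a) chart \<Rightarrow> 'p \<Rightarrow> 'a \<Rightarrow> 'a \<Rightarrow> real) \<Rightarrow> ('p \<Rightarrow> real) \<Rightarrow>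
   (('q, 'b) chart \<Rightarrow> 'q \<Rightarrow> 'b \<Rightarrow> 'b \<Rightarrow> real) \<Rightarrow>
   ('p, 'a) chart \<Rightarrow> ('q, 'b) chart \<Rightarrow> 'p \<times> 'q \<Rightarrow> 'a \<times> 'b \<Rightarrow> 'a \<times> 'b \<Rightarrow> real" where
  "warped_metric g1 f g2 a b x u v =
     g1 a (fst x) (fst u) (fst v) + (f (fst x))\<^sup>2 * g2 b (snd x) (snd u) (snd v)"

text \<open>\<open>F\<close> exhibits a submanifold of the Riemannian manifold \<open>(A, g)\<close> whose induced metric makes it
  the warped product \<open>A1 \<times>\<^sub>f A2\<close>.\<close>

definition warped_product_submanifold ::
  "('p::{t2_space,second_countable_topology}, 'a::euclidean_space) chart set \<Rightarrow>
   (('p, 'a) chart \<Rightarrow> 'p \<Rightarrow> 'a \<Rightarrow> 'a \<Rightarrow> real) \<Rightarrow> ('p \<Rightarrow> real) \<Rightarrow>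
   ('q::{t2_space,second_countable_topology}, 'b::euclidean_space) chart set \<Rightarrow>
   (('q, 'b) chart \<Rightarrow> 'q \<Rightarrow> 'b \<Rightarrow> 'b \<Rightarrow> real) \<Rightarrow>
   ('m::{t2_space,second_countable_topology}, 'e::euclidean_space) chart set \<Rightarrow>
   (('m, 'e) chart \<Rightarrow> 'm \<Rightarrow> 'e \<Rightarrow> 'e \<Rightarrow> real) \<Rightarrow> ('p \<times> 'q \<Rightarrow> 'm) \<Rightarrow> bool" where
  "warped_product_submanifold A1 g1 f A2 g2 A g F \<longleftrightarrow>
     smooth_manifold A1 \<and> riemannian_metric A1 g1 \<and>
     smooth_manifold A2 \<and> riemannian_metric A2 g2 \<and>
     smooth_function A1 f \<and> (\<forall>p. f p > 0) \<and>
     immersion (prod_atlas A1 A2) A F \<and>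
     (\<forall>a\<in>A1. \<forall>b\<in>A2. \<forall>c\<in>A. \<forall>x\<in>fst a \<times> fst b. F x \<in> fst c \<longrightarrow>
        (\<forall>u v. g c (F x) (differential (prod_chart a b) c F x u)
                         (differential (prod_chart a b) c F x v)
               = warped_metric g1 f g2 a b x u v))"

text \<open>The factors of a warped product submanifold are submanifolds of the ambient manifold as its
  leaves: \<open>L p q\<close> is the point of the ambient manifold given by \<open>p\<close> in \<open>M_T\<close> and \<open>q\<close> in \<open>M_\<theta>\<close>,
  \<open>\<lambda>p. L p q\<close> are the leaves of \<open>M_T\<close> and \<open>L p\<close> are the leaves of \<open>M_\<theta>\<close>, with slant function \<open>\<theta> p\<close>
  (a priori depending on the leaf). \<open>\<xi>\<close> is tangent to all leaves of one of the factors.\<close>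

definition semi_slant_leaves ::
  "('t::{t2_space,second_countable_topology}, 'a::euclidean_space) chart set \<Rightarrow>
   ('h::{t2_space,second_countable_topology}, 'b::euclidean_space) chart set \<Rightarrow>
   ('m::{t2_space,second_countable_topology}, 'e::euclidean_space) chart set \<Rightarrow>
   (('m, 'e) chart \<Rightarrow> 'm \<Rightarrow> 'e \<Rightarrow> 'e) \<Rightarrow> (('m, 'e) chart \<Rightarrow> 'm \<Rightarrow> 'e) \<Rightarrow>
   (('m, 'e) chart \<Rightarrow> 'm \<Rightarrow> 'e \<Rightarrow> 'e \<Rightarrow> real) \<Rightarrow>
   ('t \<Rightarrow> 'h \<Rightarrow> 'm) \<Rightarrow> ('t \<Rightarrow> 'h \<Rightarrow> real) \<Rightarrow> bool" where
  "semi_slant_leaves AT AH A \<phi> \<xi> g L \<theta> \<longleftrightarrow>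
     (\<forall>q. invariant_submanifold AT A \<phi> (\<lambda>p. L p q)) \<and>
     (\<forall>p. pointwise_slant_submanifold AH A \<phi> \<xi> g (L p) (\<theta> p)) \<and>
     ((\<forall>q. tangent_along AT A \<xi> (\<lambda>p. L p q)) \<or> (\<forall>p. tangent_along AH A \<xi> (L p)))"

definition semi_slant_warped_T_slant where
  "semi_slant_warped_T_slant AT gT f AH gH A \<phi> \<xi> g F \<theta> \<longleftrightarrow>
     warped_product_submanifold AT gT f AH gH A g F \<and>
     tangent_along (prod_atlas AT AH) A \<xi> F \<and>
     semi_slant_leaves AT AH A \<phi> \<xi> g (\<lambda>p q. F (p, q)) \<theta>"

definition semi_slant_warped_slant_T where
  "semi_slant_warped_slant_T AH gH f AT gT A \<phi> \<xi> g F \<theta> \<longleftrightarrow>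
     warped_product_submanifold AH gH f AT gT A g F \<and>
     tangent_along (prod_atlas AH AT) A \<xi> F \<and>
     semi_slant_leaves AT AH A \<phi> \<xi> g (\<lambda>p q. F (q, p)) \<theta>"

text \<open>For properness, some leaf \<open>M_\<theta>\<close> being proper pointwise slant suffices.\<close>

definition proper_T_slant where
  "proper_T_slant AT gT f AH gH A \<phi> \<xi> g F \<theta> \<longleftrightarrow>
     semi_slant_warped_T_slant AT gT f AH gH A \<phi> \<xi> g F \<theta> \<and>
     (\<exists>p. proper_pointwise_slant_submanifold AH A \<phi> \<xi> g (\<lambda>q. F (p, q)) (\<theta> p)) \<and>
     \<not> f constant_on UNIV"

definition proper_slant_T where
  "proper_slant_T AH gH f AT gT A \<phi> \<xi> g F \<theta> \<longleftrightarrow>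
     semi_slant_warped_slant_T AH gH f AT gT A \<phi> \<xi> g F \<theta> \<and>
     (\<exists>p. proper_pointwise_slant_submanifold AH A \<phi> \<xi> g (\<lambda>q. F (q, p)) (\<theta> p)) \<and>
     \<not> f constant_on UNIV"

text \<open>A contact CR-warped product has the invariant factor as its base, hence the submanifolds of
  the form \<open>M_\<theta> \<times>\<^sub>f M_T\<close> are not excepted from the nonexistence claim.\<close>

definition contact_CR_warped_product where
  "contact_CR_warped_product AT gT f AH gH A \<phi> \<xi> g F \<longleftrightarrow>
     warped_product_submanifold AT gT f AH gH A g F \<and>
     tangent_along (prod_atlas AT AH) A \<xi> F \<and>
     (\<forall>q. invariant_submanifold AT A \<phi> (\<lambda>p. F (p, q))) \<and>
     (\<forall>p. pointwise_slant_submanifold AH A \<phi> \<xi> g (\<lambda>q. F (p, q)) (\<lambda>_. pi / 2))"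

end

theory Submission
  imports Defs
begin

text \<open>One of the two factors, \<open>N\<close>, does not contain \<open>\<xi>\<close>. Since the factors of a warped product are
  orthogonal and \<open>\<xi>\<close> is tangent to the other one, \<open>\<eta>\<close> vanishes on the leaves of \<open>N\<close>, and hence so
  does its exterior derivative. On a Sasakian manifold \<open>d\<eta>\<close> is, up to a factor, the form
  \<open>g(X, \<phi>Y)\<close>, so \<open>\<phi>\<close> maps the tangent spaces of \<open>N\<close> into their orthogonal complements. For
  \<open>N = M_T\<close> this contradicts invariance, and for \<open>N = M_\<theta>\<close> it means that \<open>\<theta>\<close> is \<open>pi / 2\<close>
  identically.\<close>

section \<open>Differentiation in Euclidean spaces\<close>

lemma mvt_segment:
  fixes h :: "'f::real_normed_vector \<Rightarrow> real"
  assumes "t > 0" and diff: "\<And>s. \<lbrakk>0 \<le> s; s \<le> t\<rbrakk> \<Longrightarrow> h differentiable (at (z + s *\<^sub>R w))"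
  shows "\<exists>s. 0 < s \<and> s < t \<and> h (z + t *\<^sub>R w) - h z = t * frechet_derivative h (at (z + s *\<^sub>R w)) w"
proof -
  have der: "((\<lambda>s. h (z + s *\<^sub>R w)) has_real_derivative frechet_derivative h (at (z + s *\<^sub>R w)) w) (at s)"
    if "0 \<le> s" "s \<le> t" for s
  proof -
    let ?D = "frechet_derivative h (at (z + s *\<^sub>R w))"
    have D: "(h has_derivative ?D) (at (z + s *\<^sub>R w))"
      using diff[OF that] by (simp add: frechet_derivative_works)
    have "((\<lambda>s. z + s *\<^sub>R w) has_derivative (\<lambda>r. r *\<^sub>R w)) (at s)"
      by (auto intro!: derivative_eq_intros)
    from diff_chain_at[OF this] D
    have "((\<lambda>s. h (z + s *\<^sub>R w)) has_derivative (\<lambda>r. ?D (r *\<^sub>R w))) (at s)"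
      by (simp add: o_def)
    moreover have "(\<lambda>r. ?D (r *\<^sub>R w)) = (*) (?D w)"
      using has_derivative_linear[OF D] by (auto simp: linear_scale mult.commute)
    ultimately show ?thesis by (simp add: has_field_derivative_def)
  qed
  from MVT2[OF \<open>t > 0\<close> der] show ?thesis by fastforce
qed

text \<open>The mean value theorem is used twice on the second difference over the parallelogram
  with sides \<open>t u\<close> and \<open>t v\<close>: first along \<open>u\<close> for the
  increment of \<open>h\<close> by \<open>t v\<close>, then along \<open>v\<close> for the
  derivative of \<open>h\<close> in direction \<open>u\<close>.\<close>

lemma mixed_difference_mvt:
  fixes h :: "'f::real_normed_vector \<Rightarrow> real"
  assumes "t > 0" and S: "\<And>s r. \<lbrakk>0 \<le> s; s \<le> t; 0 \<le> r; r \<le> t\<rbrakk> \<Longrightarrow> x + s *\<^sub>R u + r *\<^sub>R v \<in> S"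
    and h: "\<And>y. y \<in> S \<Longrightarrow> h differentiable (at y)"
    and h': "\<And>y. y \<in> S \<Longrightarrow> (\<lambda>y. frechet_derivative h (at y) u) differentiable (at y)"
  shows "\<exists>s r. 0 < s \<and> s < t \<and> 0 < r \<and> r < t \<and>
    h (x + t *\<^sub>R u + t *\<^sub>R v) - h (x + t *\<^sub>R u) - h (x + t *\<^sub>R v) + h x =
    t * t * frechet_derivative (\<lambda>y. frechet_derivative h (at y) u) (at (x + s *\<^sub>R u + r *\<^sub>R v)) v"
proof -
  let ?k = "\<lambda>y. h (y + t *\<^sub>R v) - h y"
  have k: "(?k has_derivative (\<lambda>w. frechet_derivative h (at (x + s *\<^sub>R u + t *\<^sub>R v)) w
      - frechet_derivative h (at (x + s *\<^sub>R u)) w)) (at (x + s *\<^sub>R u))"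
    if "0 \<le> s" "s \<le> t" for s
  proof -
    have "x + s *\<^sub>R u \<in> S" using S[of s 0] that \<open>t > 0\<close> by simp
    then have 1: "(h has_derivative frechet_derivative h (at (x + s *\<^sub>R u))) (at (x + s *\<^sub>R u))"
      using h by (simp add: frechet_derivative_works)
    have "x + s *\<^sub>R u + t *\<^sub>R v \<in> S" using S[of s t] that \<open>t > 0\<close> by simp
    then have 2: "(h has_derivative frechet_derivative h (at (x + s *\<^sub>R u + t *\<^sub>R v)))
        (at (x + s *\<^sub>R u + t *\<^sub>R v))"
      using h by (simp add: frechet_derivative_works)
    have "((\<lambda>y. y + t *\<^sub>R v) has_derivative (\<lambda>w. w)) (at (x + s *\<^sub>R u))"
      by (auto intro!: derivative_eq_intros)
    from diff_chain_at[OF this 2] 1 show ?thesis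
      by (auto simp: o_def intro!: has_derivative_diff)
  qed
  have "?k differentiable (at (x + s *\<^sub>R u))" if "0 \<le> s" "s \<le> t" for s
    using k[OF that] by (rule differentiableI)
  from mvt_segment[OF \<open>t > 0\<close> this] obtain s where s: "0 < s" "s < t"
    and "?k (x + t *\<^sub>R u) - ?k x = t * frechet_derivative ?k (at (x + s *\<^sub>R u)) u" by blast
  then have eq: "?k (x + t *\<^sub>R u) - ?k x = t * (frechet_derivative h (at (x + s *\<^sub>R u + t *\<^sub>R v)) u
      - frechet_derivative h (at (x + s *\<^sub>R u)) u)"
    using frechet_derivative_at[OF k[of s], symmetric] by simp
  have "(\<lambda>y. frechet_derivative h (at y) u) differentiable (at (x + s *\<^sub>R u + r *\<^sub>R v))"
    if "0 \<le> r" "r \<le> t" for r using S[of s r] s that by (intro h') auto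
  from mvt_segment[OF \<open>t > 0\<close> this] obtain r where "0 < r" "r < t"
    "frechet_derivative h (at (x + s *\<^sub>R u + t *\<^sub>R v)) u - frechet_derivative h (at (x + s *\<^sub>R u)) u =
      t * frechet_derivative (\<lambda>y. frechet_derivative h (at y) u) (at (x + s *\<^sub>R u + r *\<^sub>R v)) v"
    by blast
  with eq s show ?thesis by (intro exI[of _ s] exI[of _ r]) (simp add: algebra_simps)
qed

text \<open>Schwarz's theorem. The second difference does not change when \<open>u\<close> and
  \<open>v\<close> are exchanged, so a value of one mixed derivative near \<open>x\<close> equals a
  value of the other near \<open>x\<close>; continuity moves both to \<open>x\<close>.\<close>

lemma symmetric_second_derivative_real:
  fixes h :: "'f::real_normed_vector \<Rightarrow> real"
  assumes "open S" "x \<in> S" and h: "\<And>y. y \<in> S \<Longrightarrow> h differentiable (at y)"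
    and h': "\<And>y w. y \<in> S \<Longrightarrow> (\<lambda>y. frechet_derivative h (at y) w) differentiable (at y)"
    and h'': "\<And>w w'. continuous_on S
      (\<lambda>y. frechet_derivative (\<lambda>y. frechet_derivative h (at y) w) (at y) w')"
  shows "frechet_derivative (\<lambda>y. frechet_derivative h (at y) u) (at x) v =
         frechet_derivative (\<lambda>y. frechet_derivative h (at y) v) (at x) u"
proof -
  define D where "D w w' y = frechet_derivative (\<lambda>y. frechet_derivative h (at y) w) (at y) w'" for w w' y
  have near: "\<exists>d>0. \<forall>y. dist y x < d \<longrightarrow> dist (D w w' y) (D w w' x) < e" if "e > 0" for w w' e
  proof -
    have "isCont (D w w') x"
      using h''[of w w'] \<open>open S\<close> \<open>x \<in> S\<close> unfolding D_def by (simp add: continuous_on_eq_continuous_at)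
    with that show ?thesis by (auto simp: continuous_at_eps_delta)
  qed
  have "dist (D u v x) (D v u x) < e + e" if e: "e > 0" for e
  proof -
    obtain d1 where d1: "d1 > 0" "\<And>y. dist y x < d1 \<Longrightarrow> dist (D u v y) (D u v x) < e"
      using near[OF e] by meson
    obtain d2 where d2: "d2 > 0" "\<And>y. dist y x < d2 \<Longrightarrow> dist (D v u y) (D v u x) < e"
      using near[OF e] by meson
    obtain d3 where d3: "d3 > 0" "\<And>y. dist y x < d3 \<Longrightarrow> y \<in> S"
      using \<open>open S\<close> \<open>x \<in> S\<close> by (meson open_dist)
    define d where "d = min d1 (min d2 d3)"
    \<comment> \<open>With this side length every point of the parallelogram at \<open>x\<close> is
      closer to \<open>x\<close> than \<open>d\<close>. The summand 1 keeps the denominator positive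
      and the estimate strict.\<close>
    define t where "t = d / (norm u + norm v + 1)"
    have pos: "norm u + norm v + 1 > 0" by (simp add: add_nonneg_pos)
    have "d > 0" using d1 d2 d3 by (simp add: d_def)
    with pos have "t > 0" by (simp add: t_def)
    have *: "dist (x + s *\<^sub>R u + r *\<^sub>R v) x < d" if "0 \<le> s" "s \<le> t" "0 \<le> r" "r \<le> t" for s r
    proof -
      have "dist (x + s *\<^sub>R u + r *\<^sub>R v) x \<le> s * norm u + r * norm v"
        using norm_triangle_ineq[of "s *\<^sub>R u" "r *\<^sub>R v"] that by (simp add: dist_norm add.assoc)
      also have "\<dots> \<le> t * norm u + t * norm v"
        using that by (intro add_mono mult_right_mono) auto
      also have "\<dots> < t * (norm u + norm v + 1)" using \<open>t > 0\<close> by (simp add: algebra_simps)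
      also have "\<dots> = d" using pos by (simp add: t_def)
      finally show ?thesis .
    qed
    then have inS: "x + s *\<^sub>R u + r *\<^sub>R v \<in> S" "x + s *\<^sub>R v + r *\<^sub>R u \<in> S"
      if "0 \<le> s" "s \<le> t" "0 \<le> r" "r \<le> t" for s r
      using d3(2) *[OF that] *[OF that(3,4,1,2)] by (simp_all add: d_def ac_simps)
    obtain s r where sr: "0 < s" "s < t" "0 < r" "r < t"
      "h (x + t *\<^sub>R u + t *\<^sub>R v) - h (x + t *\<^sub>R u) - h (x + t *\<^sub>R v) + h x =
        t * t * D u v (x + s *\<^sub>R u + r *\<^sub>R v)"
      using mixed_difference_mvt[OF \<open>t > 0\<close> inS(1) h h'] unfolding D_def by blast
    obtain s' r' where sr': "0 < s'" "s' < t" "0 < r'" "r' < t"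
      "h (x + t *\<^sub>R v + t *\<^sub>R u) - h (x + t *\<^sub>R v) - h (x + t *\<^sub>R u) + h x =
        t * t * D v u (x + s' *\<^sub>R v + r' *\<^sub>R u)"
      using mixed_difference_mvt[OF \<open>t > 0\<close> inS(2) h h'] unfolding D_def by blast
    have comm: "x + t *\<^sub>R v + t *\<^sub>R u = x + t *\<^sub>R u + t *\<^sub>R v" by simp
    have "t * t * D u v (x + s *\<^sub>R u + r *\<^sub>R v) = t * t * D v u (x + s' *\<^sub>R v + r' *\<^sub>R u)"
      using sr(5) sr'(5) unfolding comm by linarith
    then have eq: "D u v (x + s *\<^sub>R u + r *\<^sub>R v) = D v u (x + s' *\<^sub>R v + r' *\<^sub>R u)"
      using \<open>t > 0\<close> by simp
    have "dist (D u v (x + s *\<^sub>R u + r *\<^sub>R v)) (D u v x) < e"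
      using sr *[of s r] by (intro d1) (simp add: d_def)
    moreover have "dist (D v u (x + s' *\<^sub>R v + r' *\<^sub>R u)) (D v u x) < e"
      using sr' *[of r' s'] by (intro d2) (simp add: d_def ac_simps)
    ultimately show ?thesis unfolding eq by (metis dist_triangle3 add_strict_mono le_less_trans)
  qed
  \<comment> \<open>With half the distance as \<open>e\<close>, a positive distance would be smaller
    than itself.\<close>
  from this[of "dist (D u v x) (D v u x) / 2"] show ?thesis by (fastforce simp: D_def)
qed

lemma frechet_derivative_inner_left:
  assumes "H differentiable (at y)"
  shows "frechet_derivative (\<lambda>y. H y \<bullet> e) (at y) u = frechet_derivative H (at y) u \<bullet> e"
proof -
  have "((\<lambda>y. H y \<bullet> e) has_derivative (\<lambda>u. frechet_derivative H (at y) u \<bullet> e)) (at y)"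
    using assms by (intro has_derivative_inner_left) (simp add: frechet_derivative_works)
  from frechet_derivative_at[OF this] show ?thesis by metis
qed

text \<open>Reduction to the real case by components: the inner product with a fixed vector commutes
  with differentiation.\<close>

lemma symmetric_second_derivative:
  fixes H :: "'f::real_normed_vector \<Rightarrow> 'e::euclidean_space"
  assumes S: "open S" "x \<in> S" and "Ck_on (Suc (Suc 0)) H S"
  shows "frechet_derivative (\<lambda>y. frechet_derivative H (at y) u) (at x) v =
         frechet_derivative (\<lambda>y. frechet_derivative H (at y) v) (at x) u"
proof (rule euclidean_eqI)
  fix e :: 'e
  let ?h = "\<lambda>y. H y \<bullet> e"
  have H: "H differentiable (at y)" if "y \<in> S" for y using assms that by simp
  have H': "(\<lambda>y. frechet_derivative H (at y) w) differentiable (at y)" if "y \<in> S" for y w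
    using assms that by simp
  have H'': "continuous_on S (\<lambda>y. frechet_derivative (\<lambda>y. frechet_derivative H (at y) w) (at y) w')"
    for w w' using assms by simp
  have d1: "frechet_derivative ?h (at y) w = frechet_derivative H (at y) w \<bullet> e" if "y \<in> S" for y w
    using H[OF that] by (rule frechet_derivative_inner_left)
  \<comment> \<open>\<open>d1\<close> holds only on \<open>S\<close>, so the second derivative is
    transferred along this equality of functions on an open set.\<close>
  have d2: "((\<lambda>y. frechet_derivative ?h (at y) w) has_derivative
      (\<lambda>w'. frechet_derivative (\<lambda>y. frechet_derivative H (at y) w) (at y) w' \<bullet> e)) (at y)"
    if "y \<in> S" for y w
  proof (rule has_derivative_transform_within_open[OF _ \<open>open S\<close> that])
    show "((\<lambda>y. frechet_derivative H (at y) w \<bullet> e) has_derivative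
      (\<lambda>w'. frechet_derivative (\<lambda>y. frechet_derivative H (at y) w) (at y) w' \<bullet> e)) (at y)"
      using H'[OF that] by (intro has_derivative_inner_left) (simp add: frechet_derivative_works)
  qed (simp add: d1)
  note d3 = frechet_derivative_at[OF d2, symmetric]
  have "frechet_derivative (\<lambda>y. frechet_derivative ?h (at y) u) (at x) v =
        frechet_derivative (\<lambda>y. frechet_derivative ?h (at y) v) (at x) u"
  proof (rule symmetric_second_derivative_real[OF S])
    show "?h differentiable (at y)" if "y \<in> S" for y using H[OF that] by simp
    show "(\<lambda>y. frechet_derivative ?h (at y) w) differentiable (at y)" if "y \<in> S" for y w
      using d2[OF that] by (rule differentiableI)
    show "continuous_on S (\<lambda>y. frechet_derivative (\<lambda>y. frechet_derivative ?h (at y) w) (at y) w')"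
      for w w'
    proof -
      have "continuous_on S
          (\<lambda>y. frechet_derivative (\<lambda>y. frechet_derivative H (at y) w) (at y) w' \<bullet> e)"
        by (intro continuous_intros H'')
      then show ?thesis by (rule continuous_on_cong[THEN iffD1, rotated -1]) (simp_all add: d3)
    qed
  qed
  then show "frechet_derivative (\<lambda>y. frechet_derivative H (at y) u) (at x) v \<bullet> e =
    frechet_derivative (\<lambda>y. frechet_derivative H (at y) v) (at x) u \<bullet> e"
    by (simp add: d3 S)
qed

section \<open>Product rule and pullbacks of one-forms\<close>

text \<open>Product rule for a varying linear form evaluated at a varying vector. Expanding the
  vector in \<open>Basis\<close> gives a finite sum of products of real functions, so it suffices
  that each \<open>\<omega> z e\<close> with fixed \<open>e\<close> is differentiable.\<close>

lemma frechet_derivative_linear_family: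
  fixes \<omega> :: "'f::real_normed_vector \<Rightarrow> 'e::euclidean_space \<Rightarrow> real"
  assumes "open T" "y \<in> T" and lin: "\<And>z. z \<in> T \<Longrightarrow> linear (\<omega> z)"
    and \<omega>: "\<And>e. (\<lambda>z. \<omega> z e) differentiable (at y)" and K: "K differentiable (at y)"
  shows "frechet_derivative (\<lambda>z. \<omega> z (K z)) (at y) h =
         frechet_derivative (\<lambda>z. \<omega> z (K y)) (at y) h + \<omega> y (frechet_derivative K (at y) h)"
proof -
  define D where "D e = frechet_derivative (\<lambda>z. \<omega> z e) (at y)" for e
  define K' where "K' = frechet_derivative K (at y)"
  have D: "((\<lambda>z. \<omega> z e) has_derivative D e) (at y)" for e
    using \<omega> by (simp add: D_def frechet_derivative_works)
  have K': "(K has_derivative K') (at y)" using K by (simp add: K'_def frechet_derivative_works)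
  have expand: "(\<Sum>e\<in>Basis. (w \<bullet> e) * \<omega> z e) = \<omega> z w" if "z \<in> T" for z w
    using linear_sum[OF lin[OF that], of "\<lambda>e. (w \<bullet> e) *\<^sub>R e" Basis] lin[OF that]
    by (simp add: linear_scale euclidean_representation)
  have "((\<lambda>z. \<Sum>e\<in>Basis. (K z \<bullet> e) * \<omega> z e) has_derivative
      (\<lambda>h. \<Sum>e\<in>Basis. (K y \<bullet> e) * D e h + (K' h \<bullet> e) * \<omega> y e)) (at y)"
    by (intro has_derivative_sum has_derivative_mult D has_derivative_inner_left K')
  from has_derivative_transform_within_open[OF this \<open>open T\<close> \<open>y \<in> T\<close>, of "\<lambda>z. \<omega> z (K z)"]
  have "((\<lambda>z. \<omega> z (K z)) has_derivative
      (\<lambda>h. \<Sum>e\<in>Basis. (K y \<bullet> e) * D e h + (K' h \<bullet> e) * \<omega> y e)) (at y)" by (simp add: expand)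
  from frechet_derivative_at[OF this, symmetric]
  have 1: "frechet_derivative (\<lambda>z. \<omega> z (K z)) (at y) h =
      (\<Sum>e\<in>Basis. (K y \<bullet> e) * D e h) + \<omega> y (K' h)"
    by (simp only: sum.distrib expand[OF \<open>y \<in> T\<close>])
  have "((\<lambda>z. \<Sum>e\<in>Basis. (K y \<bullet> e) * \<omega> z e) has_derivative
      (\<lambda>h. \<Sum>e\<in>Basis. (K y \<bullet> e) * D e h)) (at y)"
    by (intro has_derivative_sum has_derivative_mult_right D)
  from has_derivative_transform_within_open[OF this \<open>open T\<close> \<open>y \<in> T\<close>, of "\<lambda>z. \<omega> z (K y)"]
  have "((\<lambda>z. \<omega> z (K y)) has_derivative (\<lambda>h. \<Sum>e\<in>Basis. (K y \<bullet> e) * D e h)) (at y)"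
    by (simp add: expand)
  from frechet_derivative_at[OF this, symmetric]
  have "frechet_derivative (\<lambda>z. \<omega> z (K y)) (at y) h = (\<Sum>e\<in>Basis. (K y \<bullet> e) * D e h)"
    by (simp only:)
  with 1 show ?thesis by (simp add: K'_def)
qed

text \<open>If the pullback \<open>H\<^sup>*\<omega>\<close> vanishes, so does \<open>H\<^sup>*d\<omega>\<close>.\<close>

lemma pullback_one_form_zero_imp_closed:
  fixes H :: "'f::real_normed_vector \<Rightarrow> 'e::euclidean_space" and \<omega> :: "'e \<Rightarrow> 'e \<Rightarrow> real"
  assumes "open T" "y \<in> T" and H: "Ck_on (Suc (Suc 0)) H T"
    and lin: "\<And>z. z \<in> T \<Longrightarrow> linear (\<omega> (H z))"
    and \<omega>: "\<And>e. (\<lambda>x. \<omega> x e) differentiable (at (H y))"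
    and zero: "\<And>z u. z \<in> T \<Longrightarrow> \<omega> (H z) (frechet_derivative H (at z) u) = 0"
  shows "frechet_derivative (\<lambda>x. \<omega> x (frechet_derivative H (at y) v)) (at (H y))
           (frechet_derivative H (at y) u) =
         frechet_derivative (\<lambda>x. \<omega> x (frechet_derivative H (at y) u)) (at (H y))
           (frechet_derivative H (at y) v)"
proof -
  have Hd: "H differentiable (at y)" and H': "(\<lambda>z. frechet_derivative H (at z) w) differentiable (at y)"
    for w using H \<open>y \<in> T\<close> by simp_all
  have comp: "frechet_derivative (\<lambda>z. \<omega> (H z) e) (at y) w =
      frechet_derivative (\<lambda>x. \<omega> x e) (at (H y)) (frechet_derivative H (at y) w)" for e w
    using frechet_derivative_compose[OF Hd \<omega>] by (simp add: o_def fun_eq_iff)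
  \<comment> \<open>Differentiating the vanishing pullback leaves the derivative of
    \<open>\<omega>\<close> balanced by \<open>\<omega>\<close> of the second derivative of
    \<open>H\<close>, and the latter is symmetric in \<open>w\<close> and \<open>w'\<close>.\<close>
  have "frechet_derivative (\<lambda>x. \<omega> x (frechet_derivative H (at y) w)) (at (H y))
          (frechet_derivative H (at y) w') =
        - \<omega> (H y) (frechet_derivative (\<lambda>z. frechet_derivative H (at z) w) (at y) w')" for w w'
  proof -
    have "((\<lambda>z. \<omega> (H z) (frechet_derivative H (at z) w)) has_derivative (\<lambda>_. 0)) (at y)"
      by (rule has_derivative_transform_within_open[OF has_derivative_const \<open>open T\<close> \<open>y \<in> T\<close>])
         (simp add: zero)
    from frechet_derivative_at[OF this]
    have "0 = frechet_derivative (\<lambda>z. \<omega> (H z) (frechet_derivative H (at z) w)) (at y) w'" by metis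
    also have "\<dots> = frechet_derivative (\<lambda>z. \<omega> (H z) (frechet_derivative H (at y) w)) (at y) w' +
        \<omega> (H y) (frechet_derivative (\<lambda>z. frechet_derivative H (at z) w) (at y) w')"
      by (rule frechet_derivative_linear_family[where \<omega> = "\<lambda>z. \<omega> (H z)", OF assms(1,2) lin])
         (use differentiable_chain_at[OF Hd \<omega>] H' in \<open>simp_all add: o_def\<close>)
    finally show ?thesis by (simp add: comp)
  qed
  with symmetric_second_derivative[OF \<open>open T\<close> \<open>y \<in> T\<close> H, of u v] show ?thesis by simp
qed

section \<open>Charts\<close>

lemma smooth_on_differentiable:
  "\<lbrakk>smooth_on S f; x \<in> S\<rbrakk> \<Longrightarrow> f differentiable (at x)"
  unfolding smooth_on_def by (metis (no_types) Ck_on.simps(2))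

lemma
  assumes "smooth_manifold A" "c \<in> A"
  shows inj_on_chart: "inj_on (snd c) (fst c)"
    and chart_inv_chart: "p \<in> fst c \<Longrightarrow> chart_inv c (snd c p) = p"
    and open_chart_image: "\<lbrakk>open U; U \<subseteq> fst c\<rbrakk> \<Longrightarrow> open (snd c ` U)"
proof -
  have hom: "homeomorphism (fst c) (snd c ` fst c) (snd c) (chart_inv c)"
    and op: "open (snd c ` fst c)"
    using assms by (auto simp: smooth_manifold_def)
  then show "inj_on (snd c) (fst c)" by (metis homeomorphism_apply1 inj_on_inverseI)
  show "p \<in> fst c \<Longrightarrow> chart_inv c (snd c p) = p" using hom by (simp add: homeomorphism_apply1)
  assume "open U" "U \<subseteq> fst c"
  then have "openin (top_of_set (snd c ` fst c)) (snd c ` U)"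
    by (intro homeomorphism_imp_open_map[OF hom] open_subset)
  with op show "open (snd c ` U)" by (simp add: openin_open_eq)
qed

lemma smooth_manifold_chart: "smooth_manifold A \<Longrightarrow> \<exists>c\<in>A. p \<in> fst c"
  unfolding smooth_manifold_def by blast

section \<open>Product charts and the leaves of a product\<close>

lemma chart_inv_prod_chart:
  assumes "smooth_manifold A" "a \<in> A" "smooth_manifold B" "b \<in> B" "p \<in> fst a" "q \<in> fst b"
  shows "chart_inv (prod_chart a b) (snd a p, snd b q) = (p, q)"
proof -
  have "inj_on (map_prod (snd a) (snd b)) (fst a \<times> fst b)"
    using assms by (intro map_prod_inj_on inj_on_chart)
  from inv_into_f_f[OF this, of "(p, q)"] show ?thesis
    using assms by (simp add: chart_inv_def prod_chart_def)
qed

text \<open>Both are partial derivatives, obtained from the chain rule with the inclusion of a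
  slice. In coordinates the composite agrees with the leaf map on the image of the chart, which is
  open and hence determines the derivative.\<close>

lemma
  assumes P: "smooth_manifold A1" "a \<in> A1" "p \<in> fst a"
    and Q: "smooth_manifold A2" "b \<in> A2" "q \<in> fst b"
    and F: "smooth_map (prod_atlas A1 A2) A F" "c \<in> A" "F (p, q) \<in> fst c"
  shows differential_prod_chart_fst:
      "differential (prod_chart a b) c F (p, q) (u, 0) = differential a c (\<lambda>p. F (p, q)) p u"
    and differential_prod_chart_snd:
      "differential (prod_chart a b) c F (p, q) (0, v) = differential b c (\<lambda>q. F (p, q)) q v"
proof -
  let ?G = "snd c \<circ> F \<circ> chart_inv (prod_chart a b)"
  let ?D = "differential (prod_chart a b) c F (p, q)"
  have "prod_chart a b \<in> prod_atlas A1 A2" using P Q unfolding prod_atlas_def by blast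
  then have "smooth_on (snd (prod_chart a b) ` (fst (prod_chart a b) \<inter> F -` fst c)) ?G"
    using F(1,2) unfolding smooth_map_def by blast
  then have "?G differentiable (at (snd a p, snd b q))"
    by (rule smooth_on_differentiable) (use P Q F in \<open>force simp: prod_chart_def\<close>)
  then have G: "(?G has_derivative ?D) (at (snd a p, snd b q))"
    by (simp add: differential_def frechet_derivative_works prod_chart_def)
  have "((\<lambda>x. (x, snd b q)) has_derivative (\<lambda>u. (u, 0))) (at (snd a p))"
    by (auto intro!: derivative_eq_intros)
  from diff_chain_at[OF this G]
  have "((snd c \<circ> (\<lambda>p. F (p, q)) \<circ> chart_inv a) has_derivative (\<lambda>u. ?D (u, 0))) (at (snd a p))"
    unfolding o_def
  proof (rule has_derivative_transform_within_open)
    show "open (snd a ` fst a)" using P(1,2) by (simp add: smooth_manifold_def)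
  qed (use P Q in \<open>auto simp: chart_inv_prod_chart chart_inv_chart\<close>)
  from frechet_derivative_at[OF this, symmetric]
  show "?D (u, 0) = differential a c (\<lambda>p. F (p, q)) p u"
    by (simp only: differential_def[of a])
  have "((\<lambda>y. (snd a p, y)) has_derivative (\<lambda>v. (0, v))) (at (snd b q))"
    by (auto intro!: derivative_eq_intros)
  from diff_chain_at[OF this G]
  have "((snd c \<circ> (\<lambda>q. F (p, q)) \<circ> chart_inv b) has_derivative (\<lambda>v. ?D (0, v))) (at (snd b q))"
    unfolding o_def
  proof (rule has_derivative_transform_within_open)
    show "open (snd b ` fst b)" using Q(1,2) by (simp add: smooth_manifold_def)
  qed (use P Q in \<open>auto simp: chart_inv_prod_chart chart_inv_chart\<close>)
  from frechet_derivative_at[OF this, symmetric]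
  show "?D (0, v) = differential b c (\<lambda>q. F (p, q)) q v"
    by (simp only: differential_def[of b])
qed

text \<open>The warped metric is a sum of a form in the first components and a form in the second
  components, so it has no cross terms.\<close>

lemma warped_product_factors_orthogonal:
  assumes W: "warped_product_submanifold A1 g1 f A2 g2 A g F"
    and P: "a \<in> A1" "p \<in> fst a" and Q: "b \<in> A2" "q \<in> fst b" and c: "c \<in> A" "F (p, q) \<in> fst c"
  shows "g c (F (p, q)) (differential a c (\<lambda>p. F (p, q)) p u) (differential b c (\<lambda>q. F (p, q)) q v) = 0"
proof -
  have M: "smooth_manifold A1" "smooth_manifold A2" "smooth_map (prod_atlas A1 A2) A F"
    and met: "riemannian_metric A1 g1" "riemannian_metric A2 g2"
    using W by (auto simp: warped_product_submanifold_def immersion_def)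
  have "bilinear (g1 a p)" "bilinear (g2 b q)" using met P Q by (auto simp: riemannian_metric_def)
  then have "warped_metric g1 f g2 a b (p, q) (u, 0) (0, v) = 0"
    by (simp add: warped_metric_def bilinear_rzero bilinear_lzero)
  moreover have "g c (F (p, q)) (differential (prod_chart a b) c F (p, q) (u, 0))
      (differential (prod_chart a b) c F (p, q) (0, v)) = warped_metric g1 f g2 a b (p, q) (u, 0) (0, v)"
    using W P Q c unfolding warped_product_submanifold_def by auto
  ultimately show ?thesis
    using differential_prod_chart_fst[OF M(1) P M(2) Q M(3) c]
      differential_prod_chart_snd[OF M(1) P M(2) Q M(3) c] by simp
qed

section \<open>Sasakian manifolds\<close>

locale sasakian =
  fixes A :: "('m::{t2_space,second_countable_topology}, 'e::euclidean_space) chart set"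
    and \<phi> :: "('m, 'e) chart \<Rightarrow> 'm \<Rightarrow> 'e \<Rightarrow> 'e"
    and \<xi> :: "('m, 'e) chart \<Rightarrow> 'm \<Rightarrow> 'e"
    and \<eta> :: "('m, 'e) chart \<Rightarrow> 'm \<Rightarrow> 'e \<Rightarrow> real"
    and g :: "('m, 'e) chart \<Rightarrow> 'm \<Rightarrow> 'e \<Rightarrow> 'e \<Rightarrow> real"
  assumes sasakian: "sasakian_manifold A \<phi> \<xi> \<eta> g"
begin

lemma manifold: "smooth_manifold A"
  and eta_form: "one_form A \<eta>"
  and phi_tensor: "tensor_field_1_1 A \<phi>"
  and metric: "riemannian_metric A g"
  using sasakian by (auto simp: sasakian_manifold_def almost_contact_metric_manifold_def)

section \<open>Pointwise algebra of the structure tensors\<close>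

context
  fixes c x
  assumes c: "c \<in> A" "x \<in> fst c"
begin

lemma phi_phi: "\<phi> c x (\<phi> c x u) = - u + \<eta> c x u *\<^sub>R \<xi> c x"
  and eta_xi: "\<eta> c x (\<xi> c x) = 1"
  and phi_xi: "\<phi> c x (\<xi> c x) = 0"
  and eta_phi: "\<eta> c x (\<phi> c x u) = 0"
  and g_phi_phi: "g c x (\<phi> c x u) (\<phi> c x v) = g c x u v - \<eta> c x u * \<eta> c x v"
  using sasakian c by (auto simp: sasakian_manifold_def almost_contact_metric_manifold_def)

lemma linear_eta: "linear (\<eta> c x)"
  and linear_phi: "linear (\<phi> c x)"
  and bilinear_g: "bilinear (g c x)"
  and g_commute: "g c x u v = g c x v u"
  and g_pos: "u \<noteq> 0 \<Longrightarrow> g c x u u > 0"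
  using eta_form phi_tensor metric c
  by (auto simp: one_form_def tensor_field_1_1_def riemannian_metric_def)

text \<open>Compatibility of \<open>g\<close> with \<open>\<phi>\<close>, taken at
  \<open>\<xi>\<close>, where \<open>\<phi>\<close> vanishes.\<close>

lemma eta_eq_g_xi: "\<eta> c x u = g c x u (\<xi> c x)"
  using g_phi_phi[of u "\<xi> c x"] by (simp add: phi_xi eta_xi bilinear_rzero[OF bilinear_g])

text \<open>Compatibility applied to \<open>u\<close> and \<open>\<phi> c x v\<close>; since
  \<open>\<eta>\<close> vanishes at \<open>v\<close>, applying \<open>\<phi>\<close> twice to
  \<open>v\<close> gives \<open>- v\<close>.\<close>

lemma g_phi_skew:
  assumes "\<eta> c x v = 0"
  shows "g c x u (\<phi> c x v) = - g c x v (\<phi> c x u)"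
proof -
  have "g c x u (\<phi> c x v) = g c x (\<phi> c x u) (- v)"
    using g_phi_phi[of u "\<phi> c x v"] by (simp add: eta_phi phi_phi assms)
  then show ?thesis by (simp add: bilinear_rneg[OF bilinear_g] g_commute[of _ v])
qed

section \<open>Derivatives of the structure tensors\<close>

lemma differentiable_phi: "(\<lambda>y. \<phi> c (chart_inv c y) v) differentiable (at (snd c x))"
  using phi_tensor c unfolding tensor_field_1_1_def
  by (meson smooth_on_differentiable imageI)

lemma differentiable_eta: "(\<lambda>y. \<eta> c (chart_inv c y) v) differentiable (at (snd c x))"
  using eta_form c unfolding one_form_def by (meson smooth_on_differentiable imageI)

text \<open>This is \<open>(\<nabla>\<^sub>u\<eta>)v = g(u, \<phi>v)\<close>. It is obtained by differentiating \<open>\<eta> \<circ> \<phi> = 0\<close>,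
  which suffices because the kernel of \<open>\<eta>\<close> is the image of \<open>\<phi>\<close>.\<close>

lemma frechet_derivative_eta:
  assumes \<Gamma>: "\<And>u v. cov_deriv_1_1 \<Gamma> \<phi> c x u v = g c x u v *\<^sub>R \<xi> c x - \<eta> c x v *\<^sub>R u"
    and v: "\<eta> c x v = 0"
  shows "frechet_derivative (\<lambda>y. \<eta> c (chart_inv c y) v) (at (snd c x)) u =
    g c x u (\<phi> c x v) + \<eta> c x (\<Gamma> c x u v)"
proof -
  \<comment> \<open>A preimage of \<open>v\<close> under \<open>\<phi>\<close> that again lies in
    the kernel of \<open>\<eta>\<close>.\<close>
  define w where "w = - \<phi> c x v"
  have w: "\<phi> c x w = v" "\<eta> c x w = 0"
    using linear_neg[OF linear_phi] linear_neg[OF linear_eta]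
    by (simp_all add: w_def phi_phi eta_phi v)
  let ?K = "\<lambda>y. \<phi> c (chart_inv c y) w" and ?T = "snd c ` fst c" and ?y = "snd c x"
  have inv: "chart_inv c (snd c p) = p" if "p \<in> fst c" for p
    using chart_inv_chart[OF manifold] c that by blast
  have T: "open ?T" "?y \<in> ?T" using manifold c by (auto simp: smooth_manifold_def)
  have "\<eta> c (chart_inv c y) (?K y) = 0" if "y \<in> ?T" for y
    using that sasakian c inv by (auto simp: sasakian_manifold_def almost_contact_metric_manifold_def)
  then have "((\<lambda>y. \<eta> c (chart_inv c y) (?K y)) has_derivative (\<lambda>_. 0)) (at ?y)"
    by (intro has_derivative_transform_within_open[OF has_derivative_const T]) simp
  from frechet_derivative_at[OF this]
  have "0 = frechet_derivative (\<lambda>y. \<eta> c (chart_inv c y) (?K y)) (at ?y) u" by metis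
  \<comment> \<open>Product rule for the vanishing function \<open>\<eta>(\<phi> w)\<close>; the
    vector frozen in the first term is \<open>\<phi> c x w = v\<close>.\<close>
  also have "\<dots> = frechet_derivative (\<lambda>y. \<eta> c (chart_inv c y) (?K ?y)) (at ?y) u
      + \<eta> c (chart_inv c ?y) (frechet_derivative ?K (at ?y) u)"
  proof (rule frechet_derivative_linear_family[OF T])
    show "linear (\<eta> c (chart_inv c z))" if "z \<in> ?T" for z
      using that eta_form c inv by (auto simp: one_form_def)
  qed (rule differentiable_eta differentiable_phi)+
  finally have "frechet_derivative (\<lambda>y. \<eta> c (chart_inv c y) v) (at ?y) u =
      - \<eta> c x (frechet_derivative ?K (at ?y) u)"
    by (simp add: inv c w)
  \<comment> \<open>The Sasakian formula for the covariant derivative of \<open>\<phi>\<close>,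
    solved for its coordinate part; the term in \<open>u\<close> drops out because
    \<open>\<eta>\<close> vanishes at \<open>w\<close>.\<close>
  also have "frechet_derivative ?K (at ?y) u =
      g c x u w *\<^sub>R \<xi> c x - \<Gamma> c x u v + \<phi> c x (\<Gamma> c x u w)"
    using \<Gamma>[of u w] by (simp add: cov_deriv_1_1_def w algebra_simps)
  also have "- \<eta> c x \<dots> = - g c x u w + \<eta> c x (\<Gamma> c x u v)"
    using linear_eta by (simp add: linear_add linear_diff linear_scale eta_xi eta_phi)
  finally show ?thesis by (simp add: w_def bilinear_rneg[OF bilinear_g])
qed

text \<open>The formula for d\<eta> on the kernel of \<open>\<eta>\<close>. The Christoffel terms of
  the two derivatives cancel because the connection is torsion-free, and skewness of
  \<open>\<phi>\<close> makes the remaining two terms equal.\<close>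

lemma exterior_derivative_eta:
  assumes "\<eta> c x u = 0" "\<eta> c x v = 0"
  shows "frechet_derivative (\<lambda>y. \<eta> c (chart_inv c y) v) (at (snd c x)) u
    - frechet_derivative (\<lambda>y. \<eta> c (chart_inv c y) u) (at (snd c x)) v = 2 * g c x u (\<phi> c x v)"
proof -
  obtain \<Gamma> where "levi_civita A g \<Gamma>" and
    cov: "\<And>u v. cov_deriv_1_1 \<Gamma> \<phi> c x u v = g c x u v *\<^sub>R \<xi> c x - \<eta> c x v *\<^sub>R u"
    using sasakian c unfolding sasakian_manifold_def by blast
  then have "\<Gamma> c x u v = \<Gamma> c x v u" using c by (auto simp: levi_civita_def)
  then show ?thesis
    using frechet_derivative_eta[OF cov assms(1), of v] frechet_derivative_eta[OF cov assms(2), of u]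
      g_phi_skew[OF assms(2), of u] by simp
qed

end

section \<open>Submanifolds on which \<eta> vanishes\<close>

text \<open>The pullback of d\<eta> vanishes with that of \<open>\<eta>\<close>, and
  \<open>exterior_derivative_eta\<close> identifies it with twice the inner product in question. As
  \<open>zero\<close> gets differentiated, it is assumed on a whole chart overlap and not just at
  one point.\<close>

lemma eta_zero_imp_anti_invariant:
  assumes B: "smooth_manifold B" "smooth_map B A i"
    and b: "b \<in> B" "p \<in> fst b" and c: "c \<in> A" "i p \<in> fst c"
    and zero: "\<And>p u. \<lbrakk>p \<in> fst b; i p \<in> fst c\<rbrakk> \<Longrightarrow> \<eta> c (i p) (differential b c i p u) = 0"
  shows "g c (i p) (differential b c i p u) (\<phi> c (i p) (differential b c i p v)) = 0"
proof -
  let ?H = "snd c \<circ> i \<circ> chart_inv b"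
  let ?U = "fst b \<inter> i -` fst c" and ?y = "snd b p"
  let ?\<omega> = "\<lambda>x. \<eta> c (chart_inv c x)"
  have inv_b: "chart_inv b (snd b r) = r" if "r \<in> fst b" for r
    using chart_inv_chart[OF B(1)] b that by blast
  have inv_c: "chart_inv c (snd c r) = r" if "r \<in> fst c" for r
    using chart_inv_chart[OF manifold] c that by blast
  have "open (fst b)" "open (fst c)"
    using B(1) b manifold c by (auto simp: smooth_manifold_def)
  moreover have "continuous_on UNIV i" using B(2) by (simp add: smooth_map_def)
  ultimately have "open ?U" by (simp add: open_Int open_vimage)
  then have T: "open (snd b ` ?U)" using open_chart_image[OF B(1) b(1)] by blast
  have y: "?y \<in> snd b ` ?U" using b c by blast
  have H: "Ck_on (Suc (Suc 0)) ?H (snd b ` ?U)"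
    using B(2) b c unfolding smooth_map_def smooth_on_def by blast
  have Hy: "?H ?y = snd c (i p)" using inv_b b by simp
  have D: "frechet_derivative ?H (at (snd b r)) = differential b c i r" for r
    by (simp add: differential_def)
  have "frechet_derivative (\<lambda>x. ?\<omega> x (frechet_derivative ?H (at ?y) v)) (at (?H ?y))
      (frechet_derivative ?H (at ?y) u) =
    frechet_derivative (\<lambda>x. ?\<omega> x (frechet_derivative ?H (at ?y) u)) (at (?H ?y))
      (frechet_derivative ?H (at ?y) v)"
  proof (rule pullback_one_form_zero_imp_closed[OF T y H])
    fix z u assume "z \<in> snd b ` ?U"
    then obtain r where r: "z = snd b r" "r \<in> fst b" "i r \<in> fst c" by blast
    show "linear (?\<omega> (?H z))" using r c by (simp add: inv_b inv_c linear_eta)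
    show "?\<omega> (?H z) (frechet_derivative ?H (at z) u) = 0"
      using zero[of r u] r D[of r] by (simp add: inv_b inv_c)
  next
    show "(\<lambda>x. ?\<omega> x e) differentiable (at (?H ?y))" for e
      unfolding Hy by (rule differentiable_eta[OF c])
  qed
  then show ?thesis
    using exterior_derivative_eta[OF c zero[OF b(2) c(2), of u] zero[OF b(2) c(2), of v]]
    unfolding Hy D by linarith
qed

text \<open>For a nonzero tangent vector \<open>v\<close>, its image under \<open>\<phi>\<close>
  would be tangent by invariance and normal by \<open>eta_zero_imp_anti_invariant\<close>, hence
  zero. But the square of \<open>\<phi>\<close> is minus the identity on the kernel of
  \<open>\<eta>\<close>.\<close>

lemma eta_zero_imp_not_invariant:
  fixes B :: "('n::{t2_space,second_countable_topology}, 'f::euclidean_space) chart set"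
  assumes "invariant_submanifold B A \<phi> i"
    and zero: "\<And>b c p u. \<lbrakk>b \<in> B; p \<in> fst b; c \<in> A; i p \<in> fst c\<rbrakk> \<Longrightarrow>
      \<eta> c (i p) (differential b c i p u) = 0"
  shows False
proof -
  have B: "smooth_manifold B" "smooth_map B A i" and imm: "immersion B A i"
    using assms(1) by (auto simp: invariant_submanifold_def immersion_def)
  fix p
  obtain b where b: "b \<in> B" "p \<in> fst b" using smooth_manifold_chart[OF B(1)] by blast
  obtain c where c: "c \<in> A" "i p \<in> fst c" using smooth_manifold_chart[OF manifold] by blast
  let ?D = "differential b c i p"
  have inj: "inj ?D" using imm b c by (simp add: immersion_def)
  obtain e :: 'f where "e \<noteq> 0" using nonzero_Basis by blast
  \<comment> \<open>Injectivity makes \<open>?D e\<close> and \<open>?D 0\<close> distinct, so at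
    least one of them is a nonzero tangent vector; this choice avoids appealing to linearity of
    \<open>?D\<close>.\<close>
  define v where "v = (if ?D e = 0 then ?D 0 else ?D e)"
  then obtain w where w: "v = ?D w" by metis
  have "v \<noteq> 0" unfolding v_def using inj \<open>e \<noteq> 0\<close> by (metis injD)
  obtain u where u: "\<phi> c (i p) v = ?D u"
    using assms(1) b c w unfolding invariant_submanifold_def tangent_space_in_def by blast
  have "g c (i p) (\<phi> c (i p) v) (\<phi> c (i p) v) = 0"
    using eta_zero_imp_anti_invariant[OF B b c zero[OF b(1) _ c(1)], of u w] u w by simp
  then have "\<phi> c (i p) v = 0" using g_pos[OF c] by force
  moreover have "\<phi> c (i p) (\<phi> c (i p) v) = - v"
    using phi_phi[OF c, of v] zero[OF b c] w by simp
  ultimately show False using \<open>v \<noteq> 0\<close> linear_0[OF linear_phi[OF c]] by simp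
qed

text \<open>By \<open>eta_zero_imp_anti_invariant\<close> the image of a tangent vector under
  \<open>\<phi>\<close> is normal, so its tangential projection and the cosine of the slant angle
  are zero.\<close>

lemma eta_zero_imp_slant_right_angle:
  fixes B :: "('n::{t2_space,second_countable_topology}, 'f::euclidean_space) chart set"
  assumes slant: "pointwise_slant_submanifold B A \<phi> \<xi> g i \<theta>"
    and zero: "\<And>b c p u. \<lbrakk>b \<in> B; p \<in> fst b; c \<in> A; i p \<in> fst c\<rbrakk> \<Longrightarrow>
      \<eta> c (i p) (differential b c i p u) = 0"
  shows "\<theta> = (\<lambda>_. pi / 2)"
proof
  fix p
  have B: "smooth_manifold B" "smooth_map B A i" and imm: "immersion B A i"
    using slant by (auto simp: pointwise_slant_submanifold_def immersion_def)
  obtain b where b: "b \<in> B" "p \<in> fst b" using smooth_manifold_chart[OF B(1)] by blast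
  obtain c where c: "c \<in> A" "i p \<in> fst c" using smooth_manifold_chart[OF manifold] by blast
  let ?D = "differential b c i p" and ?W = "tangent_space_in b c i p" and ?G = "g c (i p)"
  have inj: "inj ?D" using imm b c by (simp add: immersion_def)
  obtain e :: 'f where "e \<noteq> 0" using nonzero_Basis by blast
  have D: "linear ?D"
  proof -
    have "smooth_on (snd b ` (fst b \<inter> i -` fst c)) (snd c \<circ> i \<circ> chart_inv b)"
      using B(2) b c by (simp add: smooth_map_def)
    then have "(snd c \<circ> i \<circ> chart_inv b) differentiable (at (snd b p))"
      by (rule smooth_on_differentiable) (use b c in blast)
    then show ?thesis unfolding differential_def by (rule linear_frechet_derivative)
  qed
  define X where "X = ?D e"
  have X: "X \<in> ?W" "X \<noteq> 0"
    using inj_eq[OF inj, of e 0] \<open>e \<noteq> 0\<close> linear_0[OF D] by (auto simp: X_def tangent_space_in_def)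
  have "\<eta> c (i p) X = 0" using zero[OF b c] by (simp add: X_def)
  \<comment> \<open>A multiple of \<open>\<xi>\<close> annihilated by \<open>\<eta>\<close> is zero,
    so the slant condition does apply to \<open>X\<close>.\<close>
  then have "X \<notin> span {\<xi> c (i p)}"
    using X(2) linear_scale[OF linear_eta[OF c]] by (auto simp: span_singleton eta_xi[OF c])
  with slant b c X have angle: "angle_subspace ?G (\<phi> c (i p) X) ?W = \<theta> p"
    by (simp add: pointwise_slant_submanifold_def)
  have orth: "?G (\<phi> c (i p) X) w = 0" if w: "w \<in> ?W" for w
  proof -
    obtain u where "w = ?D u" using w by (auto simp: tangent_space_in_def)
    then show ?thesis
      using eta_zero_imp_anti_invariant[OF B b c zero[OF b(1) _ c(1)], of u e]
      by (simp add: X_def g_commute[OF c])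
  qed
  have "orth_proj ?G ?W (\<phi> c (i p) X) = 0"
    unfolding orth_proj_def
  proof (rule the_equality)
    show "0 \<in> ?W \<and> (\<forall>w\<in>?W. ?G (\<phi> c (i p) X - 0) w = 0)"
      using orth linear_0[OF D] by (auto simp: tangent_space_in_def intro: range_eqI[of _ _ 0])
    fix t assume t: "t \<in> ?W \<and> (\<forall>w\<in>?W. ?G (\<phi> c (i p) X - t) w = 0)"
    \<comment> \<open>Both the residual and the normal vector itself are orthogonal to the test
      vector \<open>w = t\<close>.\<close>
    then have "?G t t = 0" using orth by (force simp: bilinear_lsub[OF bilinear_g[OF c]])
    then show "t = 0" using g_pos[OF c] by force
  qed
  then have "angle_subspace ?G (\<phi> c (i p) X) ?W = pi / 2"
    by (simp add: angle_subspace_def bilinear_lzero[OF bilinear_g[OF c]])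
  with angle show "\<theta> p = pi / 2" by simp
qed

section \<open>Semi-slant warped products\<close>

text \<open>Since \<open>\<xi>\<close> is tangent to one factor and \<open>\<eta>\<close> is the
  inner product with \<open>\<xi>\<close>, the form \<open>\<eta>\<close> vanishes on the leaves of
  the other factor. If that is the slant factor, its angle is right; the invariant factor is ruled
  out. Stating this for \<open>L\<close> serves both orders of the factors.\<close>

lemma semi_slant_leaves_right_angle:
  assumes leaves: "semi_slant_leaves AT AH A \<phi> \<xi> g L \<theta>"
    and orth: "\<And>a b c p q u v. \<lbrakk>a \<in> AT; p \<in> fst a; b \<in> AH; q \<in> fst b; c \<in> A; L p q \<in> fst c\<rbrakk> \<Longrightarrow>
      g c (L p q) (differential a c (\<lambda>p. L p q) p u) (differential b c (L p) q v) = 0"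
  shows "\<theta> p = (\<lambda>_. pi / 2)"
proof -
  have inv: "invariant_submanifold AT A \<phi> (\<lambda>p. L p q)" for q
    using leaves by (simp add: semi_slant_leaves_def)
  have slant: "pointwise_slant_submanifold AH A \<phi> \<xi> g (L p) (\<theta> p)" for p
    using leaves by (simp add: semi_slant_leaves_def)
  have manifolds: "smooth_manifold AT" "smooth_manifold AH"
    using inv slant by (auto simp: invariant_submanifold_def pointwise_slant_submanifold_def)
  consider "\<And>q. tangent_along AT A \<xi> (\<lambda>p. L p q)" | "\<And>p. tangent_along AH A \<xi> (L p)"
    using leaves unfolding semi_slant_leaves_def by blast
  then show ?thesis
  proof cases
    case 1
    have "\<eta> c (L p q) (differential b c (L p) q u) = 0"
      if bc: "b \<in> AH" "q \<in> fst b" "c \<in> A" "L p q \<in> fst c" for b c q u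
    proof -
      obtain a where a: "a \<in> AT" "p \<in> fst a" using smooth_manifold_chart[OF manifolds(1)] by blast
      obtain w where "\<xi> c (L p q) = differential a c (\<lambda>p. L p q) p w"
        using 1[of q] a bc unfolding tangent_along_def tangent_space_in_def by blast
      then show ?thesis
        using orth[OF a bc, of w u] eta_eq_g_xi[OF bc(3,4)] g_commute[OF bc(3,4)] by metis
    qed
    with slant show ?thesis by (rule eta_zero_imp_slant_right_angle)
  next
    case 2
    \<comment> \<open>A single leaf of the invariant factor already yields a contradiction.\<close>
    fix q
    have "\<eta> c (L p q) (differential a c (\<lambda>p. L p q) p u) = 0"
      if ac: "a \<in> AT" "p \<in> fst a" "c \<in> A" "L p q \<in> fst c" for a c p u
    proof -
      obtain b where b: "b \<in> AH" "q \<in> fst b" using smooth_manifold_chart[OF manifolds(2)] by blast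
      obtain w where "\<xi> c (L p q) = differential b c (L p) q w"
        using 2[of p] b ac unfolding tangent_along_def tangent_space_in_def by blast
      then show ?thesis
        using orth[OF ac(1,2) b ac(3,4), of u w] eta_eq_g_xi[OF ac(3,4)] by metis
    qed
    with inv[of q] show ?thesis by (rule eta_zero_imp_not_invariant[THEN FalseE])
  qed
qed

lemma not_proper_slant_T: "\<not> proper_slant_T AH gH f AT gT A \<phi> \<xi> g F \<theta>"
proof
  assume proper: "proper_slant_T AH gH f AT gT A \<phi> \<xi> g F \<theta>"
  then have W: "warped_product_submanifold AH gH f AT gT A g F"
    and leaves: "semi_slant_leaves AT AH A \<phi> \<xi> g (\<lambda>p q. F (q, p)) \<theta>"
    by (simp_all add: proper_slant_T_def semi_slant_warped_slant_T_def)
  have "\<theta> p = (\<lambda>_. pi / 2)" for p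
    using leaves
  proof (rule semi_slant_leaves_right_angle)
    fix a b c p q u v
    assume "a \<in> AT" "p \<in> fst a" "b \<in> AH" "q \<in> fst b" "c \<in> A" "F (q, p) \<in> fst c"
    then show "g c (F (q, p)) (differential a c (\<lambda>p. F (q, p)) p u)
        (differential b c (\<lambda>q. F (q, p)) q v) = 0"
      \<comment> \<open>The slant factor is the base here, so orthogonality comes with its arguments
        exchanged.\<close>
      using warped_product_factors_orthogonal[OF W] g_commute by metis
  qed
  \<comment> \<open>Properness provides a leaf whose slant function is not identically
    \<open>pi / 2\<close>.\<close>
  with proper show False
    by (auto simp: proper_slant_T_def proper_pointwise_slant_submanifold_def)
qed

lemma not_proper_T_slant: "\<not> proper_T_slant AT gT f AH gH A \<phi> \<xi> g F \<theta>"
proof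
  assume proper: "proper_T_slant AT gT f AH gH A \<phi> \<xi> g F \<theta>"
  then have W: "warped_product_submanifold AT gT f AH gH A g F"
    and leaves: "semi_slant_leaves AT AH A \<phi> \<xi> g (\<lambda>p q. F (p, q)) \<theta>"
    by (simp_all add: proper_T_slant_def semi_slant_warped_T_slant_def)
  have "\<theta> p = (\<lambda>_. pi / 2)" for p
    using leaves by (rule semi_slant_leaves_right_angle) (rule warped_product_factors_orthogonal[OF W])
  with proper show False
    by (auto simp: proper_T_slant_def proper_pointwise_slant_submanifold_def)
qed

end

theorem theorem4p1:
  fixes A :: "('m::{t2_space,second_countable_topology}, 'e::euclidean_space) chart set"
    and \<phi> :: "('m, 'e) chart \<Rightarrow> 'm \<Rightarrow> 'e \<Rightarrow> 'e"
    and \<xi> :: "('m, 'e) chart \<Rightarrow> 'm \<Rightarrow> 'e"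
    and \<eta> :: "('m, 'e) chart \<Rightarrow> 'm \<Rightarrow> 'e \<Rightarrow> real"
    and g :: "('m, 'e) chart \<Rightarrow> 'm \<Rightarrow> 'e \<Rightarrow> 'e \<Rightarrow> real"
  assumes "sasakian_manifold A \<phi> \<xi> \<eta> g"
  shows "\<not> (\<exists>(AT :: ('t::{t2_space,second_countable_topology}, 'a::euclidean_space) chart set) gT
             (AH :: ('h::{t2_space,second_countable_topology}, 'b::euclidean_space) chart set) gH \<theta>.
           (\<exists>f F. proper_slant_T AH gH f AT gT A \<phi> \<xi> g F \<theta>) \<or>
           (\<exists>f F. proper_T_slant AT gT f AH gH A \<phi> \<xi> g F \<theta> \<and>
                  \<not> contact_CR_warped_product AT gT f AH gH A \<phi> \<xi> g F))"
proof -
  interpret sasakian A \<phi> \<xi> \<eta> g using assms by unfold_locales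
  show ?thesis using not_proper_slant_T not_proper_T_slant by blast
qed

end
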